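(* The permutation statistic $(a-cb)+(b-ac)+(c-ba)+[b-a)$ is Mahonian; that is, for every $n\ge1$ and every integer $k$, the number of $\pi\in\mathfrak S_n$ with $((a-cb)+(b-ac)+(c-ba)+[b-a))\,\pi=k$ equals the number of $\pi\in\mathfrak S_n$ with $\mathrm{inv}\,\pi=k$.
   Context: $\mathfrak S_n$ is the set of permutations $\pi=\pi_1\cdots\pi_n$ of $\{1,\dots,n\}$; $\mathrm{inv}\,\pi=\#\{(i,j):1\le i<j\le n,\ \pi_i>\pi_j\}$. Vincular patterns are words over letters $a<b<c$ possibly containing dashes and a leading "[" or trailing "]". An occurrence of a pattern $p=p_1\cdots p_k$ (letters, ignoring dashes and brackets) in $\pi$ is a sequence of positions $i_1<\dots<i_k$ such that $\pi_{i_1}\cdots\pi_{i_k}$ is order-isomorphic to $p_1\cdots p_k$, with $i_{r+1}=i_r+1$ whenever the $r$-th and $(r+1)$-st letters are not separated by a dash, $i_1=1$ if the pattern begins with "[", and $i_k=n$ if it ends with "]". $(\sigma+\tau+\cdots)\,\pi$ is the total number of occurrences of the listed patterns. E.g. $(b-ac)\,\pi=\#\{(i,j):i<j<n,\ \pi_j<\pi_i<\pi_{j+1}\}$ and $[b-a)\,\pi=\#\{j>1:\pi_j<\pi_1\}=\pi_1-1$. *)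

theory Defs
  imports "HOL-Combinatorics.Permutations"
begin

definition inversions :: "nat \<Rightarrow> (nat \<Rightarrow> nat) \<Rightarrow> nat" where
  "inversions n \<pi> = card {(i, j). 1 \<le> i \<and> i < j \<and> j \<le> n \<and> \<pi> i > \<pi> j}"

text \<open>
  The letters \<open>a < b < c < \<dots>\<close> are written \<open>1 < 2 < 3 < \<dots>\<close>. A number \<open>r\<close> in \<open>dashes\<close> stands
  for a dash between the \<open>r\<close>-th and the \<open>(r + 1)\<close>-st letter, counting letters from 1;
  \<open>left_anchor\<close> and \<open>right_anchor\<close> stand for a leading \<open>[\<close> and a trailing \<open>]\<close>.
\<close>

record vincular_pattern =
  left_anchor :: bool
  letters :: "nat list"
  dashes :: "nat set"
  right_anchor :: bool

definition occurrence :: "vincular_pattern \<Rightarrow> nat \<Rightarrow> (nat \<Rightarrow> nat) \<Rightarrow> nat list \<Rightarrow> bool" where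
  "occurrence p n \<pi> is \<longleftrightarrow>
     length is = length (letters p) \<and>
     set is \<subseteq> {1..n} \<and>
     sorted_wrt (<) is \<and>
     (\<forall>r < length is. \<forall>s < length is.
        \<pi> (is ! r) < \<pi> (is ! s) \<longleftrightarrow> letters p ! r < letters p ! s) \<and>
     (\<forall>r. Suc r < length is \<longrightarrow> Suc r \<notin> dashes p \<longrightarrow> is ! Suc r = is ! r + 1) \<and>
     (left_anchor p \<longrightarrow> hd is = 1) \<and>
     (right_anchor p \<longrightarrow> last is = n)"

definition pattern_stat :: "vincular_pattern list \<Rightarrow> nat \<Rightarrow> (nat \<Rightarrow> nat) \<Rightarrow> nat" where
  "pattern_stat ps n \<pi> = (\<Sum>p\<leftarrow>ps. card {is. occurrence p n \<pi> is})"

definition a_cb :: vincular_pattern where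
  "a_cb = \<lparr>left_anchor = False, letters = [1, 3, 2], dashes = {1}, right_anchor = False\<rparr>"

definition b_ac :: vincular_pattern where
  "b_ac = \<lparr>left_anchor = False, letters = [2, 1, 3], dashes = {1}, right_anchor = False\<rparr>"

definition c_ba :: vincular_pattern where
  "c_ba = \<lparr>left_anchor = False, letters = [3, 2, 1], dashes = {1}, right_anchor = False\<rparr>"

definition first_b_a :: vincular_pattern where
  "first_b_a = \<lparr>left_anchor = True, letters = [2, 1], dashes = {1}, right_anchor = False\<rparr>"

lemma occurrence_b_ac:
  "occurrence b_ac n \<pi> is \<longleftrightarrow>
     (\<exists>i j. is = [i, j, j + 1] \<and> 1 \<le> i \<and> i < j \<and> j < n \<and> \<pi> j < \<pi> i \<and> \<pi> i < \<pi> (j + 1))"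
proof (cases "\<exists>i j k. is = [i, j, k]")
  case True
  then obtain i j k where "is = [i, j, k]" by blast
  then show ?thesis
    unfolding occurrence_def b_ac_def
    by (auto simp: less_Suc_eq nth_Cons' All_less_Suc)
next
  case False
  then show ?thesis
    unfolding occurrence_def b_ac_def
    by (auto simp: length_Suc_conv numeral_eq_Suc)
qed

lemma occurrence_first_b_a:
  "occurrence first_b_a n \<pi> is \<longleftrightarrow> (\<exists>j. is = [1, j] \<and> 1 < j \<and> j \<le> n \<and> \<pi> j < \<pi> 1)"
proof (cases "\<exists>i j. is = [i, j]")
  case True
  then obtain i j where "is = [i, j]" by blast
  then show ?thesis
    unfolding occurrence_def first_b_a_def
    by (auto simp: less_Suc_eq nth_Cons' All_less_Suc)
next
  case False
  then show ?thesis
    unfolding occurrence_def first_b_a_def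
    by (auto simp: length_Suc_conv numeral_eq_Suc)
qed

end

theory Submission
  imports Defs
begin

text \<open>
  For consecutive entries \<open>x = \<pi> j\<close> and \<open>y = \<pi> (j + 1)\<close>, the three unanchored patterns together
  count the \<open>i < j\<close> for which \<open>\<pi> i\<close> lies on the open arc from \<open>x\<close> up to \<open>y\<close> of the cyclically
  ordered set \<open>{1..n}\<close>. These arc counts are invariant under rotation of the values, so they can be
  read off the word \<open>u i = (\<pi> i - \<pi> 1) mod n\<close>, which starts with its minimum \<open>0\<close>. Given the relative
  order of \<open>u 1, \<dots>, u j\<close>, the \<open>j\<close> possible relative positions of \<open>u (j + 1)\<close> correspond to the \<open>j\<close>
  possible arc counts \<open>0, \<dots>, j - 1\<close>. Hence the arc counts for \<open>j = 1, \<dots>, n - 1\<close> together with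
  \<open>\<pi> 1 - 1 < n\<close> form a code of \<open>\<pi>\<close> in \<open>[1] \<times> \<dots> \<times> [n]\<close>, with \<open>[j] = {0, \<dots>, j - 1}\<close>, whose entries
  sum to the statistic. The inversion table is another code with the same range, whose entries sum
  to the number of inversions.
\<close>

section \<open>Words with the same relative order\<close>

text \<open>The entries below the new one form an initial segment in the order of the first
  \<open>m\<close> entries, and such a segment is fixed by its size. Relative orders can thus be
  rebuilt entry by entry from ranks.\<close>

lemma same_order_Suc:
  fixes u v :: "nat \<Rightarrow> nat"
  assumes "inj_on u {1..Suc m}" "inj_on v {1..Suc m}"
    and ord: "\<And>i k. i \<in> {1..m} \<Longrightarrow> k \<in> {1..m} \<Longrightarrow> u i < u k \<longleftrightarrow> v i < v k"
    and rank: "card {i \<in> {1..m}. u i < u (Suc m)} = card {i \<in> {1..m}. v i < v (Suc m)}"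
    and "i \<in> {1..Suc m}" "k \<in> {1..Suc m}"
  shows "u i < u k \<longleftrightarrow> v i < v k"
proof -
  \<comment> \<open>Stated for arbitrary \<open>u\<close> and \<open>v\<close> because both
    directions are needed.\<close>
  have aux: "v i < v (Suc m)"
    if i: "i \<in> {1..m}" "u i < u (Suc m)" and inj: "inj_on v {1..Suc m}"
      and ord: "\<And>i k. i \<in> {1..m} \<Longrightarrow> k \<in> {1..m} \<Longrightarrow> u i < u k \<longleftrightarrow> v i < v k"
      and rank: "card {i \<in> {1..m}. u i < u (Suc m)} = card {i \<in> {1..m}. v i < v (Suc m)}"
    for u v :: "nat \<Rightarrow> nat" and i
  proof (rule ccontr)
    assume "\<not> v i < v (Suc m)"
    moreover have "v i \<noteq> v (Suc m)"
      using inj_onD[OF inj, of i "Suc m"] i by auto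
    ultimately have less: "v (Suc m) < v i" by simp
    have "{k \<in> {1..m}. v k < v (Suc m)} \<subseteq> {k \<in> {1..m}. v k < v i}"
      using less by auto
    also have "\<dots> = {k \<in> {1..m}. u k < u i}"
      using ord i by blast
    \<comment> \<open>Strict because \<open>i\<close> itself lies only in the right-hand
      set.\<close>
    also have "\<dots> \<subset> {k \<in> {1..m}. u k < u (Suc m)}"
      using i by auto
    finally have "card {k \<in> {1..m}. v k < v (Suc m)} < card {k \<in> {1..m}. u k < u (Suc m)}"
      by (intro psubset_card_mono) auto
    with rank show False by simp
  qed
  have last: "u i < u (Suc m) \<longleftrightarrow> v i < v (Suc m)" if "i \<in> {1..m}" for i
    using aux[of i u v] aux[of i v u] that assms by metis
  have neq: "u i \<noteq> u (Suc m)" "v i \<noteq> v (Suc m)" if "i \<in> {1..m}" for i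
    using that assms(1,2) by (auto dest: inj_onD)
  consider "i \<in> {1..m}" "k \<in> {1..m}" | "i \<in> {1..m}" "k = Suc m"
    | "i = Suc m" "k \<in> {1..m}" | "i = Suc m" "k = Suc m"
    using assms(5,6) by (auto simp: le_Suc_eq)
  then show ?thesis
  proof cases
    case 3
    then show ?thesis using last[of k] neq[of k] by auto
  qed (use ord last in auto)
qed

text \<open>Each value is \<open>a\<close> plus its rank. The offset \<open>a\<close> is 1 for
  permutations and 0 for rotated words.\<close>

lemma same_order_imp_eq:
  fixes u v :: "nat \<Rightarrow> nat"
  assumes "bij_betw u {1..n} {a..<a + n}" "bij_betw v {1..n} {a..<a + n}"
    and ord: "\<And>i k. i \<in> {1..n} \<Longrightarrow> k \<in> {1..n} \<Longrightarrow> u i < u k \<longleftrightarrow> v i < v k"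
    and i: "i \<in> {1..n}"
  shows "u i = v i"
proof -
  have rank: "w i = a + card {k \<in> {1..n}. w k < w i}"
    if w: "bij_betw w {1..n} {a..<a + n}" for w :: "nat \<Rightarrow> nat"
  proof -
    have "w ` {k \<in> {1..n}. w k < w i} = {a..<a + n} \<inter> {..<w i}"
      unfolding bij_betw_imp_surj_on[OF w, symmetric] by auto
    also have "\<dots> = {a..<w i}"
      using bij_betwE[OF w] i by fastforce
    finally have "card {a..<w i} = card {k \<in> {1..n}. w k < w i}"
      using card_image[OF inj_on_subset[OF bij_betw_imp_inj_on[OF w],
            of "{k \<in> {1..n}. w k < w i}"]]
      by force
    moreover have "a \<le> w i"
      using bij_betwE[OF w] i by fastforce
    ultimately show ?thesis by simp
  qed
  have "{k \<in> {1..n}. u k < u i} = {k \<in> {1..n}. v k < v i}"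
    using ord i by blast
  with rank[OF assms(1)] rank[OF assms(2)] show ?thesis by simp
qed

lemma permutes_bij_betw_shifted:
  fixes p :: "nat \<Rightarrow> nat"
  assumes "p permutes {1..n}"
  shows "bij_betw p {1..n} {1..<1 + n}"
  using permutes_imp_bij[OF assms] unfolding plus_1_eq_Suc atLeastLessThanSuc_atLeastAtMost .

section \<open>Equidistribution through codes\<close>

text \<open>The common space of codes; extensionality makes it finite, with as many elements as
  there are permutations.\<close>

definition subexcedent :: "nat \<Rightarrow> (nat \<Rightarrow> nat) set" where
  "subexcedent n = (\<Pi>\<^sub>E j\<in>{1..n}. {..<j})"

lemma card_subexcedent: "card (subexcedent n) = fact n"
  by (simp add: subexcedent_def card_PiE fact_prod)

text \<open>An injection between finite sets of the same size \<open>fact n\<close> is onto, so the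
  distribution of the code sum does not depend on the code \<open>c\<close>.\<close>

lemma card_permutes_sum_code:
  fixes c :: "(nat \<Rightarrow> nat) \<Rightarrow> nat \<Rightarrow> nat"
  assumes range: "\<And>p j. p permutes {1..n} \<Longrightarrow> j \<in> {1..n} \<Longrightarrow> c p j < j"
    and inj: "\<And>p q. p permutes {1..n} \<Longrightarrow> q permutes {1..n} \<Longrightarrow>
                (\<And>j. j \<in> {1..n} \<Longrightarrow> c p j = c q j) \<Longrightarrow> p = q"
  shows "card {p. p permutes {1..n} \<and> P (\<Sum>j\<in>{1..n}. c p j)} =
         card {f \<in> subexcedent n. P (\<Sum>j\<in>{1..n}. f j)}"
proof -
  define C where "C p = restrict (c p) {1..n}" for p
  have C: "C p j = c p j" if "j \<in> {1..n}" for p j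
    using that by (simp add: C_def)
  have inj_C: "inj_on C {p. p permutes {1..n}}"
  proof (rule inj_onI)
    fix p q assume pq: "p \<in> {p. p permutes {1..n}}" "q \<in> {p. p permutes {1..n}}" "C p = C q"
    then have "c p j = c q j" if "j \<in> {1..n}" for j
      using C[OF that] by metis
    with pq show "p = q" by (intro inj) auto
  qed
  have sub: "C ` {p. p permutes {1..n}} \<subseteq> subexcedent n"
    using range by (auto simp: C_def subexcedent_def PiE_def Pi_def)
  have fin: "finite (subexcedent n)"
    by (simp add: subexcedent_def finite_PiE)
  have img: "C ` {p. p permutes {1..n}} = subexcedent n"
    using sub by (rule card_subset_eq[OF fin])
      (simp only: card_image[OF inj_C] card_subexcedent
        card_permutations[OF card_atLeastAtMost] diff_Suc_1 finite_atLeastAtMost)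
  have sum: "(\<Sum>j\<in>{1..n}. C p j) = (\<Sum>j\<in>{1..n}. c p j)" for p
    by (intro sum.cong) (auto simp: C)
  have "C ` {p. p permutes {1..n} \<and> P (\<Sum>j\<in>{1..n}. c p j)} =
        {f \<in> subexcedent n. P (\<Sum>j\<in>{1..n}. f j)}"
    unfolding img[symmetric] sum[symmetric] by auto
  moreover have "inj_on C {p. p permutes {1..n} \<and> P (\<Sum>j\<in>{1..n}. c p j)}"
    by (rule inj_on_subset[OF inj_C]) auto
  ultimately show ?thesis
    using card_image by fastforce
qed

section \<open>Inversion tables\<close>

text \<open>Inversions are grouped by their right end, so that entry \<open>j\<close> stays below
  \<open>j\<close>.\<close>

definition inv_code :: "(nat \<Rightarrow> nat) \<Rightarrow> nat \<Rightarrow> nat" where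
  "inv_code p j = card {i \<in> {1..<j}. p j < p i}"

lemma card_less_bounded:
  assumes "1 \<le> j"
  shows "card {i \<in> {1..<j}. Q i} < j"
proof -
  have "card {i \<in> {1..<j}. Q i} \<le> card {1..<j}"
    by (intro card_mono) auto
  with assms show ?thesis by simp
qed

lemma inv_code_less: "j \<in> {1..n} \<Longrightarrow> inv_code p j < j"
  unfolding inv_code_def by (rule card_less_bounded) simp

lemma inversions_eq_sum_inv_code: "inversions n p = (\<Sum>j\<in>{1..n}. inv_code p j)"
proof -
  have "{(i, j). 1 \<le> i \<and> i < j \<and> j \<le> n \<and> p i > p j} =
        prod.swap ` (SIGMA j:{1..n}. {i \<in> {1..<j}. p j < p i})"
    by (force simp: image_iff)
  then show ?thesis
    by (simp add: inversions_def inv_code_def card_image)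
qed

lemma inv_code_inject:
  assumes p: "p permutes {1..n}" and q: "q permutes {1..n}"
    and eq: "\<And>j. j \<in> {1..n} \<Longrightarrow> inv_code p j = inv_code q j"
  shows "p = q"
proof -
  \<comment> \<open>Each earlier entry is either smaller or larger than the new one, so the code
    entry determines the rank required by \<open>same_order_Suc\<close>.\<close>
  have rank: "card {i \<in> {1..m}. r i < r (Suc m)} + inv_code r (Suc m) = m"
    if "r permutes {1..n}" for r m
  proof -
    have "card {i \<in> {1..m}. r i < r (Suc m)} + card {i \<in> {1..m}. r (Suc m) < r i} =
          card ({i \<in> {1..m}. r i < r (Suc m)} \<union> {i \<in> {1..m}. r (Suc m) < r i})"
      by (intro card_Un_disjoint[symmetric]) auto
    also have "{i \<in> {1..m}. r i < r (Suc m)} \<union> {i \<in> {1..m}. r (Suc m) < r i} = {1..m}"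
      using inj_eq[OF permutes_inj[OF that]] by (auto simp: not_less le_less)
    finally show ?thesis
      by (simp add: inv_code_def atLeastLessThanSuc_atLeastAtMost)
  qed
  have ord: "m \<le> n \<Longrightarrow> i \<in> {1..m} \<Longrightarrow> k \<in> {1..m} \<Longrightarrow> p i < p k \<longleftrightarrow> q i < q k" for m i k
  proof (induction m arbitrary: i k)
    case (Suc m)
    show ?case
    proof (rule same_order_Suc[OF _ _ _ _ Suc.prems(2,3)])
      show "card {i \<in> {1..m}. p i < p (Suc m)} = card {i \<in> {1..m}. q i < q (Suc m)}"
        using rank[OF p, of m] rank[OF q, of m] eq[of "Suc m"] Suc.prems(1) by simp
    qed (use Suc p q in \<open>auto intro: permutes_inj_on\<close>)
  qed auto
  show ?thesis
  proof
    fix i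
    show "p i = q i"
    proof (cases "i \<in> {1..n}")
      case True
      show ?thesis
        using same_order_imp_eq[OF p[THEN permutes_bij_betw_shifted]
            q[THEN permutes_bij_betw_shifted] ord[OF order_refl] True] .
    next
      case False
      then show ?thesis using p q by (simp add: permutes_not_in)
    qed
  qed
qed

section \<open>Arc codes\<close>

text \<open>The second case is the arc that wraps around past the largest value.\<close>

definition in_arc :: "nat \<Rightarrow> nat \<Rightarrow> nat \<Rightarrow> bool" where
  "in_arc x z y \<longleftrightarrow> (if x < y then x < z \<and> z < y else z < y \<or> x < z)"

definition arc_count :: "(nat \<Rightarrow> nat) \<Rightarrow> nat \<Rightarrow> nat" where
  "arc_count p j = card {i \<in> {1..<j}. in_arc (p j) (p i) (p (Suc j))}"

text \<open>Adjacent pairs use only the indices below \<open>n\<close>; the free slot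
  \<open>n\<close> keeps the first value, which rotation forgets.\<close>

definition arc_code :: "nat \<Rightarrow> (nat \<Rightarrow> nat) \<Rightarrow> nat \<Rightarrow> nat" where
  "arc_code n p j = (if j = n then p 1 - 1 else arc_count p j)"

section \<open>Pattern occurrences as arc counts\<close>

lemma occurrence_a_cb:
  "occurrence a_cb n \<pi> is \<longleftrightarrow>
     (\<exists>i j. is = [i, j, j + 1] \<and> 1 \<le> i \<and> i < j \<and> j < n \<and> \<pi> i < \<pi> (j + 1) \<and> \<pi> (j + 1) < \<pi> j)"
proof (cases "\<exists>i j k. is = [i, j, k]")
  case True
  then obtain i j k where "is = [i, j, k]" by blast
  then show ?thesis
    unfolding occurrence_def a_cb_def
    by (auto simp: less_Suc_eq nth_Cons' All_less_Suc)
next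
  case False
  then show ?thesis
    unfolding occurrence_def a_cb_def
    by (auto simp: length_Suc_conv numeral_eq_Suc)
qed

lemma occurrence_c_ba:
  "occurrence c_ba n \<pi> is \<longleftrightarrow>
     (\<exists>i j. is = [i, j, j + 1] \<and> 1 \<le> i \<and> i < j \<and> j < n \<and> \<pi> (j + 1) < \<pi> j \<and> \<pi> j < \<pi> i)"
proof (cases "\<exists>i j k. is = [i, j, k]")
  case True
  then obtain i j k where "is = [i, j, k]" by blast
  then show ?thesis
    unfolding occurrence_def c_ba_def
    by (auto simp: less_Suc_eq nth_Cons' All_less_Suc)
next
  case False
  then show ?thesis
    unfolding occurrence_def c_ba_def
    by (auto simp: length_Suc_conv numeral_eq_Suc)
qed

lemma card_dashed_triples:
  fixes n :: nat
  shows "card {is. \<exists>i j. is = [i, j, j + 1] \<and> 1 \<le> i \<and> i < j \<and> j < n \<and> Q i j} =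
     (\<Sum>j\<in>{1..<n}. card {i \<in> {1..<j}. Q i j})"
proof -
  have "{is. \<exists>i j. is = [i, j, j + 1] \<and> 1 \<le> i \<and> i < j \<and> j < n \<and> Q i j} =
        (\<lambda>(j, i). [i, j, j + 1]) ` (SIGMA j:{1..<n}. {i \<in> {1..<j}. Q i j})"
    by (force simp: image_iff)
  moreover have "inj_on (\<lambda>(j, i). [i, j, j + 1]) (SIGMA j:{1..<n}. {i \<in> {1..<j}. Q i j})"
    by (auto simp: inj_on_def)
  ultimately show ?thesis
    by (simp only: card_image) (intro card_SigmaI, auto)
qed

lemma card_first_b_a:
  assumes p: "p permutes {1..n}" and n: "1 \<le> n"
  shows "card {is. occurrence first_b_a n p is} = p 1 - 1"
proof -
  have "{is. occurrence first_b_a n p is} = (\<lambda>j. [1, j]) ` {j \<in> {1..n}. p j < p 1}"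
    unfolding occurrence_first_b_a by (auto simp: image_iff le_less)
  moreover have "inj_on (\<lambda>j. [1, j]) {j \<in> {1..n}. p j < p 1}"
    by (auto simp: inj_on_def)
  ultimately have "card {is. occurrence first_b_a n p is} = card {j \<in> {1..n}. p j < p 1}"
    by (simp add: card_image)
  also have "\<dots> = card (p ` {j \<in> {1..n}. p j < p 1})"
    using p by (intro card_image[symmetric] permutes_inj_on)
  \<comment> \<open>Counting values instead of positions: every value below \<open>p 1\<close> is
    taken exactly once.\<close>
  also have "p ` {j \<in> {1..n}. p j < p 1} = p ` {1..n} \<inter> {..<p 1}"
    by auto
  also have "\<dots> = {1..<p 1}"
    using permutes_image[OF p] permutes_in_image[OF p, of 1] n by auto
  finally show ?thesis by simp
qed

text \<open>At an ascent the arc gives the pattern b-ac. At a descent it wraps and splits into a low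
  piece, giving a-cb, and a high piece, giving c-ba.\<close>

lemma arc_count_eq_patterns:
  assumes "inj p"
  shows "arc_count p j = card {i \<in> {1..<j}. p i < p (j + 1) \<and> p (j + 1) < p j} +
     card {i \<in> {1..<j}. p j < p i \<and> p i < p (j + 1)} +
     card {i \<in> {1..<j}. p (j + 1) < p j \<and> p j < p i}" (is "_ = card ?A + card ?B + card ?C")
proof -
  have "p j \<noteq> p (Suc j)"
    using inj_eq[OF assms] by simp
  then have "{i \<in> {1..<j}. in_arc (p j) (p i) (p (Suc j))} = (?A \<union> ?B) \<union> ?C"
    by (auto simp: in_arc_def split: if_splits)
  moreover have "card ((?A \<union> ?B) \<union> ?C) = card (?A \<union> ?B) + card ?C"
    by (intro card_Un_disjoint) auto
  moreover have "card (?A \<union> ?B) = card ?A + card ?B"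
    by (intro card_Un_disjoint) auto
  ultimately show ?thesis by (simp only: arc_count_def)
qed

lemma pattern_stat_eq_sum_arc_code:
  assumes p: "p permutes {1..n}" and n: "1 \<le> n"
  shows "pattern_stat [a_cb, b_ac, c_ba, first_b_a] n p = (\<Sum>j\<in>{1..n}. arc_code n p j)"
proof -
  have "{1..n} = insert n {1..<n}" using n by auto
  then have "(\<Sum>j\<in>{1..n}. arc_code n p j) = p 1 - 1 + (\<Sum>j\<in>{1..<n}. arc_count p j)"
    by (simp add: arc_code_def)
  moreover have "card {is. occurrence a_cb n p is} =
      (\<Sum>j\<in>{1..<n}. card {i \<in> {1..<j}. p i < p (j + 1) \<and> p (j + 1) < p j})"
    unfolding occurrence_a_cb by (rule card_dashed_triples)
  moreover have "card {is. occurrence b_ac n p is} =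
      (\<Sum>j\<in>{1..<n}. card {i \<in> {1..<j}. p j < p i \<and> p i < p (j + 1)})"
    unfolding occurrence_b_ac by (rule card_dashed_triples)
  moreover have "card {is. occurrence c_ba n p is} =
      (\<Sum>j\<in>{1..<n}. card {i \<in> {1..<j}. p (j + 1) < p j \<and> p j < p i})"
    unfolding occurrence_c_ba by (rule card_dashed_triples)
  ultimately show ?thesis
    unfolding pattern_stat_def arc_count_eq_patterns[OF permutes_inj[OF p]] sum.distrib
    using card_first_b_a[OF p n] by simp
qed

section \<open>Rotation of the values\<close>

text \<open>For \<open>a\<close> and \<open>t\<close> in \<open>{1..n}\<close> this is the residue
  of t - a modulo \<open>n\<close>, written without truncated subtraction.\<close>

definition shift_mod :: "nat \<Rightarrow> nat \<Rightarrow> nat \<Rightarrow> nat" where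
  "shift_mod n a t = (if a \<le> t then t - a else t + n - a)"

text \<open>Rotation moves the block of values from \<open>a\<close> on in front of the values below
  \<open>a\<close> and keeps the order inside each block.\<close>

lemma shift_mod_less_iff:
  assumes "a \<in> {1..n}" "s \<in> {1..n}" "t \<in> {1..n}"
  shows "shift_mod n a s < shift_mod n a t \<longleftrightarrow>
    (if a \<le> s \<longleftrightarrow> a \<le> t then s < t else a \<le> s)"
  using assms by (auto simp: shift_mod_def)

lemma inj_on_shift_mod:
  assumes "a \<in> {1..n}"
  shows "inj_on (shift_mod n a) {1..n}"
proof (rule inj_onI)
  fix s t assume "s \<in> {1..n}" "t \<in> {1..n}" "shift_mod n a s = shift_mod n a t"
  then show "s = t"
    using shift_mod_less_iff[OF assms, of s t] shift_mod_less_iff[OF assms, of t s]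
    by (auto split: if_splits)
qed

text \<open>Arc membership of distinct values depends only on their cyclic order, which rotation
  preserves.\<close>

lemma in_arc_shift_mod:
  assumes a: "a \<in> {1..n}" and xyz: "x \<in> {1..n}" "y \<in> {1..n}" "z \<in> {1..n}"
    and neq: "x \<noteq> y" "x \<noteq> z" "y \<noteq> z"
  shows "in_arc (shift_mod n a x) (shift_mod n a z) (shift_mod n a y) \<longleftrightarrow> in_arc x z y"
  using neq unfolding in_arc_def shift_mod_less_iff[OF a xyz(1,2)]
    shift_mod_less_iff[OF a xyz(1,3)] shift_mod_less_iff[OF a xyz(3,2)]
  by (cases "a \<le> x"; cases "a \<le> y"; cases "a \<le> z"; simp; linarith)

definition rotated :: "nat \<Rightarrow> (nat \<Rightarrow> nat) \<Rightarrow> nat \<Rightarrow> nat" where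
  "rotated n p i = shift_mod n (p 1) (p i)"

lemma rotated_first: "rotated n p 1 = 0"
  by (simp add: rotated_def shift_mod_def)

text \<open>The interval is written in the form that \<open>same_order_imp_eq\<close> takes for the
  offset 0.\<close>

lemma bij_betw_rotated:
  assumes p: "p permutes {1..n}" and n: "1 \<le> n"
  shows "bij_betw (rotated n p) {1..n} {0..<0 + n}"
proof -
  have p1: "p 1 \<in> {1..n}"
    using permutes_in_image[OF p, of 1] n by simp
  have inj: "inj_on (rotated n p) {1..n}"
    unfolding rotated_def
    using comp_inj_on[OF permutes_inj_on[OF p], of "shift_mod n (p 1)" "{1..n}"]
      inj_on_shift_mod[OF p1] permutes_image[OF p]
    by (simp add: comp_def)
  have "rotated n p ` {1..n} \<subseteq> {0..<n}"
  proof
    fix t assume "t \<in> rotated n p ` {1..n}"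
    then obtain i where "i \<in> {1..n}" "t = rotated n p i" by blast
    then show "t \<in> {0..<n}"
      using permutes_in_image[OF p, of i] p1 by (auto simp: rotated_def shift_mod_def)
  qed
  then have "rotated n p ` {1..n} = {0..<n}"
    by (intro card_subset_eq) (simp_all only: card_image[OF inj] finite_atLeastLessThan
        card_atLeastAtMost card_atLeastLessThan diff_Suc_1 diff_zero)
  with inj show ?thesis by (simp add: bij_betw_def)
qed

lemma arc_count_rotated:
  assumes p: "p permutes {1..n}" and j: "1 \<le> j" "j < n"
  shows "arc_count (rotated n p) j = arc_count p j"
proof -
  have "in_arc (rotated n p j) (rotated n p i) (rotated n p (Suc j)) \<longleftrightarrow>
        in_arc (p j) (p i) (p (Suc j))" if i: "i \<in> {1..<j}" for i
  proof -
    have "p i \<noteq> p j" "p i \<noteq> p (Suc j)" "p j \<noteq> p (Suc j)"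
      using inj_eq[OF permutes_inj[OF p]] i by auto
    moreover have "p t \<in> {1..n}" if "t \<in> {1, i, j, Suc j}" for t
      using permutes_in_image[OF p, of t] that i j by auto
    ultimately show ?thesis
      unfolding rotated_def by (intro in_arc_shift_mod) simp_all
  qed
  then show ?thesis
    unfolding arc_count_def by (intro arg_cong[where f = card]) auto
qed

section \<open>Recovering the relative order from arc counts\<close>

text \<open>
  Here \<open>r\<close> and \<open>s\<close> are the ranks of \<open>u m\<close> and \<open>u (m + 1)\<close> among \<open>u 1, \<dots>, u m\<close>. Since \<open>u 1\<close> is
  minimal, \<open>s \<ge> 1\<close>, so the two cases of the equation give arc counts in disjoint ranges and \<open>s\<close> is
  determined by \<open>r\<close> and the arc count.
\<close>

lemma arc_count_rank:
  fixes u :: "nat \<Rightarrow> nat"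
  assumes inj: "inj_on u {1..Suc m}" and m: "1 \<le> m" and u1: "u 1 = 0"
  defines "r \<equiv> card {i \<in> {1..m}. u i < u m}" and "s \<equiv> card {i \<in> {1..m}. u i < u (Suc m)}"
  shows "1 \<le> s \<and> s \<le> m \<and> r < m \<and>
    (if r < s then r + 1 + arc_count u m = s else arc_count u m + r + 1 = m + s)"
proof -
  have neq: "u i \<noteq> u k" if "i \<in> {1..Suc m}" "k \<in> {1..Suc m}" "i \<noteq> k" for i k
    using inj_onD[OF inj] that by blast
  have "0 < u (Suc m)"
    using neq[of 1 "Suc m"] u1 m by auto
  then have "1 \<in> {i \<in> {1..m}. u i < u (Suc m)}"
    using u1 m by simp
  then have s1: "1 \<le> s"
    unfolding s_def using card_mono[of "{i \<in> {1..m}. u i < u (Suc m)}" "{1}"] by simp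
  have sm: "s \<le> m"
    using card_less_bounded[of "Suc m"] by (simp add: s_def less_Suc_eq_le)
  have r_alt: "{i \<in> {1..m}. u i < u m} = {i \<in> {1..<m}. u i < u m}"
    by (auto simp: le_less)
  have rm: "r < m"
    unfolding r_def r_alt using card_less_bounded[OF m] .
  define R where "R = {i \<in> {1..m}. u i < u m}"
  define S where "S = {i \<in> {1..m}. u i < u (Suc m)}"
  define D where "D = {i \<in> {1..<m}. in_arc (u m) (u i) (u (Suc m))}"
  define U where "U = {i \<in> {1..<m}. u m < u i}"
  have fin: "finite R" "finite S" "finite D" "finite U"
    by (auto simp: R_def S_def D_def U_def)
  have mR: "m \<notin> R"
    by (simp add: R_def)
  have cards: "card R = r" "card S = s" "card D = arc_count u m"
    by (simp_all add: R_def S_def D_def r_def s_def arc_count_def)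
  show ?thesis
  proof (cases "u m < u (Suc m)")
    case True
    \<comment> \<open>Ascent: below the new entry lie \<open>u m\<close>, everything below
      \<open>u m\<close>, and the arc.\<close>
    have "i \<in> S \<longleftrightarrow> i \<in> insert m R \<union> D" for i
      using True neq[of i m] m
      by (cases "i = m") (auto simp: R_def S_def D_def in_arc_def)
    then have "S = insert m R \<union> D" by blast
    moreover have "insert m R \<inter> D = {}"
      using True by (auto simp: R_def D_def in_arc_def)
    ultimately have "card S = card (insert m R) + card D"
      using card_Un_disjoint[of "insert m R" D] fin by simp
    then have "s = r + 1 + arc_count u m"
      using fin mR cards by simp
    then show ?thesis using s1 sm rm by simp
  next
    case False
    then have gt: "u (Suc m) < u m"
      using neq[of m "Suc m"] m by auto
    \<comment> \<open>Descent: the wrapping arc consists of the entries below the new one and those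
      above \<open>u m\<close>; the latter number m - 1 - r.\<close>
    have "D = S \<union> U"
      using gt by (auto simp: S_def D_def U_def in_arc_def le_less)
    moreover have "S \<inter> U = {}"
      using gt by (auto simp: S_def U_def)
    ultimately have D: "card D = card S + card U"
      using fin by (simp add: card_Un_disjoint)
    have "i \<in> {1..m} \<longleftrightarrow> i \<in> insert m R \<union> U" for i
      using neq[of i m] m by (cases "i = m") (auto simp: R_def U_def)
    then have "{1..m} = insert m R \<union> U" by blast
    moreover have "insert m R \<inter> U = {}"
      by (auto simp: R_def U_def)
    ultimately have "card {1..m} = card (insert m R) + card U"
      using card_Un_disjoint[of "insert m R" U] fin by simp
    then have "m = r + 1 + card U"
      using fin mR cards by simp
    moreover have "s \<le> r"
      unfolding r_def s_def using gt by (intro card_mono) auto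
    ultimately show ?thesis using s1 sm rm D cards by simp
  qed
qed

text \<open>By induction the rank of \<open>u m\<close> is known, and with the arc count it fixes
  the rank of the next entry, hence its place by \<open>same_order_Suc\<close>.\<close>

lemma arc_count_same_order:
  fixes u v :: "nat \<Rightarrow> nat"
  assumes "inj_on u {1..n}" "inj_on v {1..n}" "u 1 = 0" "v 1 = 0"
    and eq: "\<And>j. 1 \<le> j \<Longrightarrow> j < n \<Longrightarrow> arc_count u j = arc_count v j"
  shows "m \<le> n \<Longrightarrow> i \<in> {1..m} \<Longrightarrow> k \<in> {1..m} \<Longrightarrow> u i < u k \<longleftrightarrow> v i < v k"
proof (induction m arbitrary: i k)
  case (Suc m)
  have inj: "inj_on u {1..Suc m}" "inj_on v {1..Suc m}"
    using assms(1,2)[THEN inj_on_subset] Suc.prems(1) by simp_all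
  have ord: "u i < u k \<longleftrightarrow> v i < v k" if "i \<in> {1..m}" "k \<in> {1..m}" for i k
    using Suc.IH Suc.prems(1) that by simp
  have "card {i \<in> {1..m}. u i < u (Suc m)} = card {i \<in> {1..m}. v i < v (Suc m)}"
  proof (cases "m = 0")
    case False
    then have m: "1 \<le> m" by simp
    have "{i \<in> {1..m}. u i < u m} = {i \<in> {1..m}. v i < v m}"
      using ord m by auto
    \<comment> \<open>The two words cannot fall into different branches of
      \<open>arc_count_rank\<close>: with equal \<open>r\<close> and arc count, r + 1 plus the count
      is at most \<open>m\<close> in one branch and exceeds \<open>m\<close> in the other.\<close>
    then show ?thesis
      using arc_count_rank[OF inj(1) m assms(3)] arc_count_rank[OF inj(2) m assms(4)]
        eq[OF m] Suc.prems(1)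
      by (auto split: if_splits)
  qed simp
  then show ?case
    using same_order_Suc[OF inj ord _ Suc.prems(2,3)] by blast
qed auto

section \<open>Arc codes determine permutations\<close>

lemma arc_code_less:
  assumes p: "p permutes {1..n}" and j: "j \<in> {1..n}"
  shows "arc_code n p j < j"
proof (cases "j = n")
  case True
  then show ?thesis
    using permutes_in_image[OF p, of 1] j by (auto simp: arc_code_def)
next
  case False
  then show ?thesis
    using card_less_bounded[of j] j by (simp add: arc_code_def arc_count_def)
qed

text \<open>The arc counts recover the rotated word; the last entry recovers the first value, by
  which the rotation is undone.\<close>

lemma arc_code_inject:
  assumes p: "p permutes {1..n}" and q: "q permutes {1..n}" and n: "1 \<le> n"
    and eq: "\<And>j. j \<in> {1..n} \<Longrightarrow> arc_code n p j = arc_code n q j"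
  shows "p = q"
proof -
  note bij = bij_betw_rotated[OF p n] bij_betw_rotated[OF q n]
  have cnt: "arc_count (rotated n p) j = arc_count (rotated n q) j" if "1 \<le> j" "j < n" for j
    using eq[of j] that arc_count_rotated[OF p that] arc_count_rotated[OF q that]
    by (simp add: arc_code_def)
  have ord: "rotated n p i < rotated n p k \<longleftrightarrow> rotated n q i < rotated n q k"
    if "i \<in> {1..n}" "k \<in> {1..n}" for i k
    using arc_count_same_order[OF bij[THEN bij_betw_imp_inj_on] rotated_first rotated_first
        cnt order_refl that] .
  have bd: "p i \<in> {1..n}" "q i \<in> {1..n}" if "i \<in> {1..n}" for i
    using permutes_in_image[OF p, of i] permutes_in_image[OF q, of i] that by simp_all
  \<comment> \<open>Both first values are at least 1, so the truncated subtraction in entry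
    \<open>n\<close> loses nothing.\<close>
  have first: "p 1 = q 1"
    using eq[of n] bd[of 1] n by (auto simp: arc_code_def)
  show ?thesis
  proof
    fix i
    show "p i = q i"
    proof (cases "i \<in> {1..n}")
      case True
      then have "rotated n p i = rotated n q i"
        using same_order_imp_eq[OF bij ord] by blast
      then show ?thesis
        using inj_onD[OF inj_on_shift_mod[OF bd(2)[of 1]] _ bd[OF True]] n
        unfolding rotated_def first by simp
    next
      case False
      then show ?thesis using p q by (simp add: permutes_not_in)
    qed
  qed
qed

theorem theorem1:
  fixes n :: nat and k :: int
  assumes "n \<ge> 1"
  shows "card {\<pi>. \<pi> permutes {1..n} \<and>
             int (pattern_stat [a_cb, b_ac, c_ba, first_b_a] n \<pi>) = k} =
         card {\<pi>. \<pi> permutes {1..n} \<and> int (inversions n \<pi>) = k}"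
proof -
  \<comment> \<open>Both counts are compared with this set, which mentions neither
    statistic.\<close>
  let ?codes = "{f \<in> subexcedent n. int (\<Sum>j\<in>{1..n}. f j) = k}"
  have "card {\<pi>. \<pi> permutes {1..n} \<and> int (\<Sum>j\<in>{1..n}. arc_code n \<pi> j) = k} = card ?codes"
    by (rule card_permutes_sum_code[where P = "\<lambda>s. int s = k",
          OF arc_code_less arc_code_inject[OF _ _ assms]])
  moreover have
    "card {\<pi>. \<pi> permutes {1..n} \<and> int (\<Sum>j\<in>{1..n}. inv_code \<pi> j) = k} = card ?codes"
    by (rule card_permutes_sum_code[where P = "\<lambda>s. int s = k", OF inv_code_less inv_code_inject])
  moreover have
    "{\<pi>. \<pi> permutes {1..n} \<and> int (pattern_stat [a_cb, b_ac, c_ba, first_b_a] n \<pi>) = k} =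
     {\<pi>. \<pi> permutes {1..n} \<and> int (\<Sum>j\<in>{1..n}. arc_code n \<pi> j) = k}"
    using pattern_stat_eq_sum_arc_code assms by auto
  ultimately show ?thesis
    by (simp only: inversions_eq_sum_inv_code)
qed

end
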